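(* Consider a circuit in the class RLCM$a$ (described in the context, with all memristor and topological assumptions stated there), so that every one of the $n_C$ capacitors has a flux-controlled memristor in parallel ($n_\Phi=n_C$) and there are no other memristors. Let $$H_{\alpha\alpha}=A_{CR}R_{\mathcal L}^{-1}A_{CR}^\top,\quad H_{\alpha\beta}=A_{CL},\quad H_{\beta\beta}=A_{RL}^\top R_{\mathcal T}A_{RL},\quad H=\begin{pmatrix} H_{\alpha\alpha} & H_{\alpha\beta} \\ -H_{\alpha\beta}^\top & H_{\beta\beta} \end{pmatrix}.$$ Suppose that: 1) $G_{\mathrm m}:=\min_{i=1,\dots,n_\Phi}G_{mi}>|\mu(H_{\alpha\alpha})|$, where $\mu(H_{\alpha\alpha})$ is the least eigenvalue of the symmetric matrix $H_{\alpha\alpha}$; 2) the symmetric matrix $H_{\beta\beta}$ is positive definite; 3) $\|L^{1/2}H_{\beta\beta}^{-1}H_{\alpha\beta}^\top C^{-1/2}\|_2<1$, where $\|\cdot\|_2$ is the spectral norm. Then, for any $v_{C0}\in\mathbb R^{n_C}$, $i_{L0}\in\mathbb R^{n_L}$, $\Phi_{M0}\in\mathbb R^{n_C}$, any solution $(\varphi_C,q_L)$ of the state equations in the flux-charge domain $$\begin{pmatrix} C\dot\varphi_C \\ L\dot q_L \end{pmatrix}=-H\begin{pmatrix} \varphi_C \\ q_L \end{pmatrix}-\begin{pmatrix} \hat Q_{MC}(\varphi_C+\Phi_{M0})-\hat Q_{MC}(\Phi_{M0}) \\ 0 \end{pmatrix}+\begin{pmatrix} C v_{C0} \\ L i_{L0}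 \end{pmatrix}$$ is bounded and converges as $t\to+\infty$ to the set $E$ of equilibrium points of this system; moreover, it converges to a single point $(\bar\varphi_C,\bar q_L)\in E$ when the equilibrium points are isolated.
   Context: Circuit. A connected digraph whose branches are: $n_C$ capacitive branches, each consisting of a capacitor $C_i>0$ in parallel with a flux-controlled memristor with characteristic $\hat Q_{Mi}:\mathbb R\to\mathbb R$; $n_L$ inductive branches, each a single inductor $L_i>0$; and linear resistors with resistances $R_i\ne0$ of either sign. Topological assumption. There is a spanning tree $\mathcal T$ with co-tree $\mathcal L$ such that all capacitive branches belong to $\mathcal T$ and the other branches of $\mathcal T$ are resistors; all inductive branches belong to $\mathcal L$ and the other branches of $\mathcal L$ are resistors; each resistor in $\mathcal L$ forms a (fundamental) loop exclusively with capacitive branches. Matrices. Kirchhoff's charge law for the fundamental cut-sets reads $q_{\mathcal T}+Aq_{\mathcal L}=0$, where $q_{\mathcal T},q_{\mathcal L}$ are the tree and co-tree branch charges and $A$ has entries in $\{-1,0,1\}$. Partition $A=\begin{pmatrix} A_{CL} & A_{CR} \\ A_{RL} & A_{RR} \end{pmatrix}$, with rows split into capacitive tree branches and tree resistors, and columns split into inductive co-tree branches and co-tree resistors (under the topological assumption $A_{RR}=0$). $R_{\mathcal T}$, $R_{\mathcal L}$ are the diagonal matrices of the resistances of the resistors in $\mathcal T$, $\mathcal L$; $C=\mathrm{diag}(C_1,\dots,C_{n_C})$, $L=\mathrm{diag}(L_1,\dots,L_{n_L})$; $\hat Q_{MC}(x)=(\hat Q_{M1}(x_1),\dots,\hat Q_{Mn_C}(x_{n_C}))$.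 Memristor assumption. For each $i$: $\hat Q_{Mi}\in C^1(\mathbb R)$, $\hat Q_{Mi}(0)=0$, $\hat Q_{Mi}'\ge0$ everywhere, and $G_{mi}>0$, $\tilde\Phi_{Mi}>0$ are constants such that $\hat Q_{Mi}(\Phi)/\Phi\ge G_{mi}$ for $|\Phi|>\tilde\Phi_{Mi}$. Convergence of a solution to a set means that its distance from the set tends to $0$ as $t\to+\infty$. *)

theory Defs
  imports "HOL-Analysis.Analysis" "Graph_Theory.Digraph_Component"
begin

section \<open>Loops and spanning trees\<close>

text \<open>
  The predicates \<^const>\<open>pre_digraph.cycle\<close> and \<^const>\<open>forest\<close> of the graph library see only
  \<^emph>\<open>directed\<close> cycles, whereas loops and trees of a circuit ignore the reference directions of the
  branches. A loop is therefore a cycle of the digraph in which every arc may be traversed in both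
  directions, subject to no arc being used twice (so going back and forth along one arc is no
  loop, but two parallel arcs form one).
\<close>

definition bidirected :: "('v, 'e) pre_digraph \<Rightarrow> ('v, 'e \<times> bool) pre_digraph" where
  "bidirected G = \<lparr> verts = verts G, arcs = arcs G \<times> UNIV,
     tail = (\<lambda>(e, forward). if forward then tail G e else head G e),
     head = (\<lambda>(e, forward). if forward then head G e else tail G e) \<rparr>"

definition is_loop :: "('v, 'e) pre_digraph \<Rightarrow> 'e set \<Rightarrow> bool" where
  "is_loop G S \<longleftrightarrow>
     (\<exists>p. pre_digraph.cycle (bidirected G) p \<and> distinct (map fst p) \<and> S = fst ` set p)"

definition spanning_subgraph :: "('v, 'e) pre_digraph \<Rightarrow> 'e set \<Rightarrow> ('v, 'e) pre_digraph" where
  "spanning_subgraph G T = G\<lparr>arcs := T\<rparr>"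

definition is_spanning_tree :: "('v, 'e) pre_digraph \<Rightarrow> 'e set \<Rightarrow> bool" where
  "is_spanning_tree G T \<longleftrightarrow> T \<subseteq> arcs G
     \<and> Digraph_Component.connected (spanning_subgraph G T)
     \<and> (\<nexists>S. is_loop (spanning_subgraph G T) S)"

text \<open>
  Removing the tree branch \<open>t\<close> splits the tree into two parts; \<open>cut_side G T t\<close> is the part
  containing the tail of \<open>t\<close>. Kirchhoff's charge law for this cut, oriented along \<open>t\<close>, reads
  \<open>q t + (\<Sum>l. cut_coeff G T t l * q l) = 0\<close> with \<open>l\<close> ranging over the co-tree branches.
\<close>

definition cut_side :: "('v, 'e) pre_digraph \<Rightarrow> 'e set \<Rightarrow> 'e \<Rightarrow> 'v set" where
  "cut_side G T t =
     {v. reachable (with_proj (mk_symmetric (spanning_subgraph G (T - {t})))) (tail G t) v}"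

definition cut_coeff :: "('v, 'e) pre_digraph \<Rightarrow> 'e set \<Rightarrow> 'e \<Rightarrow> 'e \<Rightarrow> real" where
  "cut_coeff G T t l =
     (if tail G l \<in> cut_side G T t \<and> head G l \<notin> cut_side G T t then 1
      else if tail G l \<notin> cut_side G T t \<and> head G l \<in> cut_side G T t then - 1
      else 0)"


section \<open>The circuits\<close>

text \<open>
  Branches are the arcs of a multidigraph. A capacitive branch \<open>Cap i\<close> is the parallel connection of
  a capacitor and a memristor. The index types of capacitive and inductive branches are finite
  types; the resistors of tree and co-tree are given by sets \<open>RT\<close>, \<open>RL\<close>, either of which may be
  empty.
\<close>

datatype ('c, 'l, 'r) branch = Cap 'c | Ind 'l | Res 'r

type_synonym ('v, 'c, 'l, 'r) network = "('v, ('c, 'l, 'r) branch) pre_digraph"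

definition tree_branches :: "'r set \<Rightarrow> ('c, 'l, 'r) branch set" where
  "tree_branches RT = range Cap \<union> Res ` RT"

definition cotree_branches :: "'r set \<Rightarrow> ('c, 'l, 'r) branch set" where
  "cotree_branches RL = range Ind \<union> Res ` RL"

locale RLCMa =
  fixes G :: "('v, 'c::finite, 'l::finite, 'r) network"
    and RT RL :: "'r set"
    and R :: "'r \<Rightarrow> real" and C :: "'c \<Rightarrow> real" and L :: "'l \<Rightarrow> real"
    and QM :: "'c \<Rightarrow> real \<Rightarrow> real"
    and Gm \<Phi>m :: "'c \<Rightarrow> real"
  assumes digraph: "fin_digraph G" "Digraph_Component.connected G"
    and branches: "arcs G = tree_branches RT \<union> cotree_branches RL" "RT \<inter> RL = {}"
    and spanning_tree: "is_spanning_tree G (tree_branches RT)"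
    and cotree_resistor_loops:
      "\<And>r. r \<in> RL \<Longrightarrow> \<exists>S. is_loop G S \<and> Res r \<in> S \<and> S \<subseteq> insert (Res r) (range Cap)"
    and resistances: "\<And>r. r \<in> RT \<union> RL \<Longrightarrow> R r \<noteq> 0"
    and capacitances: "\<And>i. C i > 0"
    and inductances: "\<And>j. L j > 0"
    and memristor_C1: "\<And>i. QM i C1_differentiable_on UNIV"
    and memristor_zero: "\<And>i. QM i 0 = 0"
    and memristor_passive: "\<And>i x. deriv (QM i) x \<ge> 0"
    and memristor_constants_pos: "\<And>i. Gm i > 0" "\<And>i. \<Phi>m i > 0"
    and memristor_growth: "\<And>i x. \<bar>x\<bar> > \<Phi>m i \<Longrightarrow> QM i x / x \<ge> Gm i"


section \<open>Matrices\<close>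

definition diag :: "('n \<Rightarrow> real) \<Rightarrow> real^'n^'n" where
  "diag d = (\<chi> i j. if i = j then d i else 0)"

definition least_eigenvalue :: "real^'n^'n \<Rightarrow> real" where
  "least_eigenvalue M = (LEAST k. \<exists>v. v \<noteq> 0 \<and> M *v v = k *\<^sub>R v)"

definition positive_definite :: "real^'n^'n \<Rightarrow> bool" where
  "positive_definite M \<longleftrightarrow> transpose M = M \<and> (\<forall>x. x \<noteq> 0 \<longrightarrow> x \<bullet> (M *v x) > 0)"

definition spectral_norm :: "real^'n^'m \<Rightarrow> real" where
  "spectral_norm M = onorm (\<lambda>x. M *v x)"

context
  fixes G :: "('v, 'c::finite, 'l::finite, 'r) network"
    and RT RL :: "'r set" and R :: "'r \<Rightarrow> real"
begin

definition cutset_matrix ::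
    "('c, 'l, 'r) branch \<Rightarrow> ('c, 'l, 'r) branch \<Rightarrow> real" where
  "cutset_matrix t l = cut_coeff G (tree_branches RT) t l"

text \<open>Entrywise, \<open>A\<^sub>C\<^sub>R R\<^sub>\<L>\<^sup>-\<^sup>1 A\<^sub>C\<^sub>R\<^sup>T\<close>, \<open>A\<^sub>C\<^sub>L\<close> and \<open>A\<^sub>R\<^sub>L\<^sup>T R\<^sub>\<T> A\<^sub>R\<^sub>L\<close>.\<close>

definition H_alpha_alpha :: "real^'c^'c" where
  "H_alpha_alpha = (\<chi> i j. \<Sum>r\<in>RL.
     cutset_matrix (Cap i) (Res r) * inverse (R r) * cutset_matrix (Cap j) (Res r))"

definition H_alpha_beta :: "real^'l^'c" where
  "H_alpha_beta = (\<chi> i j. cutset_matrix (Cap i) (Ind j))"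

definition H_beta_beta :: "real^'l^'l" where
  "H_beta_beta = (\<chi> j k. \<Sum>r\<in>RT.
     cutset_matrix (Res r) (Ind j) * R r * cutset_matrix (Res r) (Ind k))"

definition H_matrix :: "real^('c + 'l)^('c + 'l)" where
  "H_matrix = (\<chi> a b. case (a, b) of
       (Inl i, Inl j) \<Rightarrow> H_alpha_alpha $ i $ j
     | (Inl i, Inr j) \<Rightarrow> H_alpha_beta $ i $ j
     | (Inr i, Inl j) \<Rightarrow> - (transpose H_alpha_beta $ i $ j)
     | (Inr i, Inr j) \<Rightarrow> H_beta_beta $ i $ j)"

end


section \<open>State equations\<close>

definition stack :: "real^'c \<Rightarrow> real^'l \<Rightarrow> real^('c + 'l)" where
  "stack u w = (\<chi> a. case a of Inl i \<Rightarrow> u $ i | Inr j \<Rightarrow> w $ j)"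

definition QMC :: "('c \<Rightarrow> real \<Rightarrow> real) \<Rightarrow> real^'c \<Rightarrow> real^'c" where
  "QMC QM x = (\<chi> i. QM i (x $ i))"

definition state_rhs ::
    "('v, 'c::finite, 'l::finite, 'r) network \<Rightarrow> 'r set \<Rightarrow> 'r set \<Rightarrow> ('r \<Rightarrow> real)
      \<Rightarrow> ('c \<Rightarrow> real) \<Rightarrow> ('l \<Rightarrow> real) \<Rightarrow> ('c \<Rightarrow> real \<Rightarrow> real)
      \<Rightarrow> real^'c \<Rightarrow> real^'l \<Rightarrow> real^'c \<Rightarrow> real^'c \<Rightarrow> real^'l \<Rightarrow> real^('c + 'l)" where
  "state_rhs G RT RL R C L QM vC0 iL0 \<Phi>M0 \<phi> q =
     - (H_matrix G RT RL R *v stack \<phi> q)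
     - stack (QMC QM (\<phi> + \<Phi>M0) - QMC QM \<Phi>M0) 0
     + stack (diag C *v vC0) (diag L *v iL0)"

definition equilibria ::
    "('v, 'c::finite, 'l::finite, 'r) network \<Rightarrow> 'r set \<Rightarrow> 'r set \<Rightarrow> ('r \<Rightarrow> real)
      \<Rightarrow> ('c \<Rightarrow> real) \<Rightarrow> ('l \<Rightarrow> real) \<Rightarrow> ('c \<Rightarrow> real \<Rightarrow> real)
      \<Rightarrow> real^'c \<Rightarrow> real^'l \<Rightarrow> real^'c \<Rightarrow> ((real^'c) \<times> (real^'l)) set" where
  "equilibria G RT RL R C L QM vC0 iL0 \<Phi>M0 =
     {(\<phi>, q). state_rhs G RT RL R C L QM vC0 iL0 \<Phi>M0 \<phi> q = 0}"

text \<open>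
  Solutions live on an interval \<open>[0, \<tau>)\<close> with \<open>0 < \<tau> \<le> \<infinity>\<close>, so that absence of finite escape time is
  not built into the notion of solution. At \<open>t = 0\<close> the derivative is one-sided.
\<close>

definition time_interval :: "ereal \<Rightarrow> real set" where
  "time_interval \<tau> = {t. 0 \<le> t \<and> ereal t < \<tau>}"

definition is_solution ::
    "('v, 'c::finite, 'l::finite, 'r) network \<Rightarrow> 'r set \<Rightarrow> 'r set \<Rightarrow> ('r \<Rightarrow> real)
      \<Rightarrow> ('c \<Rightarrow> real) \<Rightarrow> ('l \<Rightarrow> real) \<Rightarrow> ('c \<Rightarrow> real \<Rightarrow> real)
      \<Rightarrow> real^'c \<Rightarrow> real^'l \<Rightarrow> real^'c
      \<Rightarrow> ereal \<Rightarrow> (real \<Rightarrow> real^'c) \<Rightarrow> (real \<Rightarrow> real^'l) \<Rightarrow> bool" where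
  "is_solution G RT RL R C L QM vC0 iL0 \<Phi>M0 \<tau> \<phi> q \<longleftrightarrow>
     (\<forall>t\<in>time_interval \<tau>. \<exists>\<phi>' q'.
        (\<phi> has_vector_derivative \<phi>') (at t within time_interval \<tau>)
      \<and> (q has_vector_derivative q') (at t within time_interval \<tau>)
      \<and> stack (diag C *v \<phi>') (diag L *v q')
          = state_rhs G RT RL R C L QM vC0 iL0 \<Phi>M0 (\<phi> t) (q t))"

text \<open>Nonemptiness is required because \<open>infdist x {} = 0\<close> in the library.\<close>

definition converges_to_set :: "(real \<Rightarrow> 'a::metric_space) \<Rightarrow> 'a set \<Rightarrow> bool" where
  "converges_to_set x E \<longleftrightarrow> E \<noteq> {} \<and> ((\<lambda>t. infdist (x t) E) \<longlongrightarrow> 0) at_top"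

end

theory Submission
  imports Defs
begin

text \<open>
  Write \<open>P = H\<^sub>\<alpha>\<^sub>\<alpha>\<close>, \<open>N = H\<^sub>\<alpha>\<^sub>\<beta>\<close>, \<open>B = H\<^sub>\<beta>\<^sub>\<beta>\<close>. For frozen \<open>\<phi>\<close> the second equation has the equilibrium
  \<open>q\<^sup>* = S \<phi> + s\<close> with \<open>S = B\<inverse> N\<^sup>T\<close>. Following Brayton and Moser, the content of the \<open>\<phi>\<close>-equation with
  \<open>q = q\<^sup>*\<close> inserted, plus \<open>z \<bullet> B z / 2\<close> for \<open>z = q - q\<^sup>*\<close>, is a Lyapunov function: its derivative is
  \<open>- \<phi>' \<bullet> C \<phi>' - q' \<bullet> L q' + 2 (S \<phi>') \<bullet> L q'\<close>, which the bound on \<open>L\<^sup>1\<^sup>/\<^sup>2 S C\<^sup>-\<^sup>1\<^sup>/\<^sup>2\<close> makes at most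
  \<open>- c \<parallel>(\<phi>', q')\<parallel>\<^sup>2\<close>. The growth of the memristor charges beats the negative part of \<open>P\<close>, so this
  function has bounded sublevel sets and solutions are bounded. The square of the velocity is then
  integrable and uniformly continuous, hence the velocity tends to \<open>0\<close>, and compactness gives
  convergence to the zeros of the vector field.
\<close>

section \<open>Trajectories with vanishing velocity\<close>

text \<open>A Barbalat argument. Since \<open>u\<close> is Lipschitz and \<open>f\<close> is
  uniformly continuous on the compact orbit closure, a speed of at least \<open>e\<close> stays
  above \<open>e / 2\<close> for a fixed time and makes \<open>v\<close> drop by a fixed amount.
  This is impossible once \<open>v\<close> is close to its infimum.\<close>

lemma dissipation_imp_velocity_tendsto_0:
  fixes u :: "real \<Rightarrow> 'a::euclidean_space" and f :: "'a \<Rightarrow> 'a"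
  assumes f: "continuous_on UNIV f"
    and u: "\<And>t. t \<ge> 0 \<Longrightarrow> (u has_vector_derivative f (u t)) (at t within {0..})"
    and bdd: "bounded (u ` {0..})"
    and v: "\<And>t. t \<ge> 0 \<Longrightarrow> (v has_real_derivative D t) (at t within {0..})"
    and D: "\<And>t. t \<ge> 0 \<Longrightarrow> D t \<le> - c * (norm (f (u t)))\<^sup>2" and "c > 0"
    and below: "\<And>t. t \<ge> 0 \<Longrightarrow> m \<le> v t"
  shows "((\<lambda>t. f (u t)) \<longlongrightarrow> 0) at_top"
proof -
  define K where "K = closure (u ` {0..})"
  have K: "compact K" using bdd by (simp add: K_def compact_closure)
  have uK: "u t \<in> K" if "t \<ge> 0" for t
    using that closure_subset[of "u ` {0..}"] by (auto simp: K_def)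
  have "bounded (f ` K)"
    using K f by (meson compact_continuous_image compact_imp_bounded continuous_on_subset subset_UNIV)
  then obtain M where "M > 0" and M: "\<And>x. x \<in> K \<Longrightarrow> norm (f x) \<le> M"
    by (auto simp: bounded_pos)
  have speed: "onorm (\<lambda>h. h *\<^sub>R f (u t)) \<le> M" if "t \<ge> 0" for t
    using mult_right_mono[OF M[OF uK[OF that]] abs_ge_zero]
    by (intro onorm_le) (simp add: mult.commute)
  have lip: "norm (u s - u t) \<le> M * norm (s - t)" if "s \<ge> 0" "t \<ge> 0" for s t
    using that u speed
    by (intro differentiable_bound[of "{0..}" u "\<lambda>t h. h *\<^sub>R f (u t)"])
       (auto simp: has_vector_derivative_def)
  have uc: "uniformly_continuous_on K f"
    using K f by (meson compact_uniformly_continuous continuous_on_subset subset_UNIV)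
  \<comment> \<open>Derivatives are known only within \<open>{0..}\<close>, hence one-sided at 0, so
    the mean value theorem is used in its form relative to \<open>{s..t}\<close>.\<close>
  have mvt: "\<exists>\<xi>\<in>{s<..<t}. v t - v s = D \<xi> * (t - s)" if "0 \<le> s" "s < t" for s t
  proof (rule mvt_simple[where f' = "\<lambda>x h. D x * h", OF \<open>s < t\<close>])
    show "(v has_derivative (\<lambda>h. D x * h)) (at x within {s..t})" if "s \<le> x" for x
      by (rule has_derivative_subset[of _ _ _ "{0..}"])
         (use v[of x] that \<open>0 \<le> s\<close> in \<open>auto simp: has_field_derivative_def\<close>)
  qed
  have dec: "v t \<le> v s" if "0 \<le> s" "s \<le> t" for s t
  proof (cases "s = t")
    case False
    then have "\<exists>\<xi>\<in>{s<..<t}. v t - v s = D \<xi> * (t - s)"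
      using mvt that by simp
    then obtain \<xi> where \<xi>: "s < \<xi>" "v t - v s = D \<xi> * (t - s)" by auto
    have "D \<xi> \<le> 0" using D[of \<xi>] \<xi> that \<open>c > 0\<close>
      by (smt (verit) mult_minus_left mult_nonneg_nonneg zero_le_power2)
    then show ?thesis using \<xi> that by (smt (verit) mult_nonpos_nonneg)
  qed simp
  define l where "l = Inf (v ` {0..})"
  have bb: "bdd_below (v ` {0..})" using below by (auto simp: bdd_below_def)
  have l_le: "l \<le> v t" if "t \<ge> 0" for t
    unfolding l_def using bb that by (intro cInf_lower) auto
  show ?thesis
  proof (rule tendstoI)
    fix e :: real assume "e > 0"
    then obtain d where "d > 0"
      and d: "\<And>x x'. x \<in> K \<Longrightarrow> x' \<in> K \<Longrightarrow> dist x' x < d \<Longrightarrow> dist (f x') (f x) < e / 2"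
      using uc unfolding uniformly_continuous_on_def by (metis half_gt_zero)
    \<comment> \<open>At speed at most \<open>M\<close> the trajectory moves by at most
      \<open>d / 2\<close> in time \<open>h\<close>, so \<open>f\<close> along it changes by less
      than \<open>e / 2\<close>.\<close>
    define h where "h = d / (2 * M)"
    have "h > 0" using \<open>d > 0\<close> \<open>M > 0\<close> by (simp add: h_def)
    \<comment> \<open>The drop of \<open>v\<close> that a speed of at least \<open>e / 2\<close>
      forces in time \<open>h\<close>.\<close>
    define \<eta> where "\<eta> = c * (e / 2)\<^sup>2 * h"
    have "\<eta> > 0" using \<open>h > 0\<close> \<open>e > 0\<close> \<open>c > 0\<close> by (simp add: \<eta>_def)
    then have "\<exists>y\<in>v ` {0..}. y < l + \<eta>"
      using bb cInf_less_iff[of "v ` {0..}" "l + \<eta>"] by (auto simp: l_def)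
    then obtain T where T: "T \<ge> 0" "v T < l + \<eta>" by auto
    have "norm (f (u t)) < e" if "t \<ge> T" for t
    proof (rule ccontr)
      assume "\<not> norm (f (u t)) < e"
      then have big: "norm (f (u t)) \<ge> e" by simp
      have t0: "t \<ge> 0" using that T by simp
      obtain s where s: "s \<in> {t<..<t+h}" "v (t + h) - v t = D s * h"
        using mvt[of t "t + h"] t0 \<open>h > 0\<close> by auto
      have "norm (u s - u t) \<le> M * norm (s - t)" using lip[of s t] s t0 by auto
      also have "\<dots> \<le> M * h" using s \<open>M > 0\<close> by (intro mult_left_mono) auto
      also have "\<dots> < d" using \<open>M > 0\<close> \<open>d > 0\<close> by (simp add: h_def)
      finally have "dist (f (u s)) (f (u t)) < e / 2"
        using s t0 by (intro d uK) (auto simp: dist_norm)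
      then have "norm (f (u s)) \<ge> e / 2"
        using big norm_triangle_ineq2[of "f (u t)" "f (u s)"]
        by (simp add: dist_norm norm_minus_commute)
      then have "c * (e / 2)\<^sup>2 \<le> c * (norm (f (u s)))\<^sup>2"
        using \<open>c > 0\<close> \<open>e > 0\<close> by (intro mult_left_mono power_mono) auto
      then have "D s \<le> - (c * (e / 2)\<^sup>2)" using D[of s] s t0 by auto
      then have "D s * h \<le> - \<eta>"
        using mult_right_mono[of "D s" "- (c * (e / 2)\<^sup>2)" h] \<open>h > 0\<close> by (simp add: \<eta>_def)
      \<comment> \<open>Monotonicity gives \<open>v t \<le> v T < l + \<eta>\<close>, so a drop of
        \<open>\<eta>\<close> after \<open>t\<close> would take \<open>v\<close> below its infimum
        \<open>l\<close>.\<close>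
      then show False using s(2) l_le[of "t + h"] dec[of T t] T that t0 \<open>h > 0\<close> by linarith
    qed
    then show "\<forall>\<^sub>F t in at_top. dist (f (u t)) 0 < e"
      unfolding eventually_at_top_linorder by auto
  qed
qed

text \<open>On a nonempty \<open>K\<close> the norm of \<open>f\<close> attains a positive minimum,
  and \<open>f (u t)\<close> is eventually smaller than that.\<close>

lemma eventually_notin_compact_if_no_zero:
  fixes f :: "'a::metric_space \<Rightarrow> 'b::real_normed_vector"
  assumes f: "continuous_on UNIV f" and lim: "((\<lambda>t. f (u t)) \<longlongrightarrow> 0) F"
    and K: "compact K" and nz: "\<And>x. x \<in> K \<Longrightarrow> f x \<noteq> 0"
  shows "\<forall>\<^sub>F t in F. u t \<notin> K"
proof (cases "K = {}")
  case False
  have "continuous_on K (\<lambda>x. norm (f x))"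
    using f continuous_on_norm continuous_on_subset by blast
  then obtain x where x: "x \<in> K" "\<And>y. y \<in> K \<Longrightarrow> norm (f x) \<le> norm (f y)"
    using continuous_attains_inf[OF K False] by metis
  have "\<forall>\<^sub>F t in F. dist (f (u t)) 0 < norm (f x)"
    using lim nz[OF x(1)] by (intro tendstoD) auto
  then show ?thesis by eventually_elim (use x(2) in force)
qed simp

text \<open>The points of the orbit closure at distance at least \<open>e\<close> from the zero set
  form a compact set without zeros, which the trajectory eventually avoids.\<close>

lemma converges_to_zero_set:
  fixes f :: "'a::euclidean_space \<Rightarrow> 'b::real_normed_vector"
  assumes f: "continuous_on UNIV f" and lim: "((\<lambda>t. f (u t)) \<longlongrightarrow> 0) at_top"
    and bdd: "bounded (u ` {0::real..})"
  shows "converges_to_set u {x. f x = 0}"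
proof -
  let ?E = "{x. f x = 0}"
  define K where "K = closure (u ` {0..})"
  have K: "compact K" using bdd by (simp add: K_def compact_closure)
  have uK: "u t \<in> K" if "t \<ge> 0" for t
    using that closure_subset[of "u ` {0..}"] by (auto simp: K_def)
  \<comment> \<open>If \<open>f\<close> had no zero, the trajectory would have to leave its own
    closure.\<close>
  have "?E \<noteq> {}"
  proof
    assume "?E = {}"
    then have "\<forall>\<^sub>F t in at_top. u t \<notin> K"
      by (intro eventually_notin_compact_if_no_zero[OF f lim K]) auto
    then have "\<forall>\<^sub>F t::real in at_top. False"
      using eventually_ge_at_top[of 0] by eventually_elim (use uK in auto)
    then show False by simp
  qed
  moreover have "((\<lambda>t. infdist (u t) ?E) \<longlongrightarrow> 0) at_top"
  proof (rule tendstoI)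
    fix e :: real assume e: "e > 0"
    have "compact (K \<inter> {x. e \<le> infdist x ?E})"
      by (intro compact_Int_closed K closed_Collect_le continuous_intros)
    then have "\<forall>\<^sub>F t in at_top. u t \<notin> K \<inter> {x. e \<le> infdist x ?E}"
      by (rule eventually_notin_compact_if_no_zero[OF f lim]) (use e in auto)
    then show "\<forall>\<^sub>F t in at_top. dist (infdist (u t) ?E) 0 < e"
      using eventually_ge_at_top[of 0]
      by eventually_elim (use uK in \<open>auto simp: infdist_nonneg\<close>)
  qed
  ultimately show ?thesis by (simp add: converges_to_set_def)
qed

text \<open>Near an isolated zero the trajectory eventually avoids every small sphere, so by
  connectedness it is trapped inside as soon as it accumulates at the centre.\<close>

lemma tendsto_isolated_zero:
  fixes f :: "'a::euclidean_space \<Rightarrow> 'b::real_normed_vector"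
  assumes f: "continuous_on UNIV f" and lim: "((\<lambda>t. f (u t)) \<longlongrightarrow> 0) at_top"
    and bdd: "bounded (u ` {0::real..})" and u: "continuous_on {0..} u"
    and disc: "discrete {x. f x = 0}"
  shows "\<exists>e. f e = 0 \<and> (u \<longlongrightarrow> e) at_top"
proof -
  \<comment> \<open>Sampling at integer times yields an accumulation point \<open>e\<close>, the
    candidate limit; continuity of \<open>f\<close> makes it a zero.\<close>
  have "bounded (range (\<lambda>n. u (real n)))" using bdd by (rule bounded_subset) auto
  then obtain e r where r: "strict_mono r" and lim_e: "(\<lambda>n. u (real (r n))) \<longlonglongrightarrow> e"
    using bounded_imp_convergent_subsequence[of "\<lambda>n. u (real n)"] by (auto simp: o_def)
  have top: "filterlim (\<lambda>n. real (r n)) at_top sequentially"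
    using r filterlim_subseq filterlim_compose filterlim_real_sequentially by blast
  have "(\<lambda>n. f (u (real (r n)))) \<longlonglongrightarrow> f e"
    using f lim_e by (rule continuous_on_tendsto_compose) auto
  moreover have "(\<lambda>n. f (u (real (r n)))) \<longlonglongrightarrow> 0"
    using filterlim_compose[OF lim top] .
  ultimately have fe: "f e = 0" using LIMSEQ_unique by blast
  then obtain d where "d > 0" and d: "\<And>x. f x = 0 \<Longrightarrow> dist e x < d \<Longrightarrow> x = e"
    using disc unfolding discrete_def isolated_in_dist_Ex_iff by force
  have "(u \<longlongrightarrow> e) at_top"
  proof (rule tendstoI)
    fix \<epsilon>' :: real assume "\<epsilon>' > 0"
    \<comment> \<open>The cap \<open>d / 2\<close> keeps the sphere of radius
      \<open>\<epsilon>\<close> inside the ball in which \<open>e\<close> is the only zero.\<close>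
    define \<epsilon> where "\<epsilon> = min \<epsilon>' (d / 2)"
    have \<epsilon>: "\<epsilon> > 0" "\<epsilon> < d" "\<epsilon> \<le> \<epsilon>'" using \<open>\<epsilon>' > 0\<close> \<open>d > 0\<close> by (auto simp: \<epsilon>_def)
    have "\<forall>\<^sub>F t in at_top. u t \<notin> sphere e \<epsilon>"
      using eventually_notin_compact_if_no_zero[OF f lim compact_sphere] d \<epsilon> by force
    then obtain T0 where T0: "\<And>t. t \<ge> T0 \<Longrightarrow> u t \<notin> sphere e \<epsilon>"
      by (auto simp: eventually_at_top_linorder)
    define T where "T = max T0 0"
    have "\<forall>\<^sub>F n in sequentially. dist (u (real (r n))) e < \<epsilon>"
      using lim_e \<epsilon>(1) by (rule tendstoD)
    moreover have "\<forall>\<^sub>F n in sequentially. real (r n) \<ge> T"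
      using top by (simp add: filterlim_at_top)
    ultimately have "\<forall>\<^sub>F n in sequentially. dist (u (real (r n))) e < \<epsilon> \<and> real (r n) \<ge> T"
      by (rule eventually_conj)
    then obtain s where s: "s \<ge> T" "dist (u s) e < \<epsilon>"
      using eventually_happens'[OF sequentially_bot] by force
    have conn: "topological_space_class.connected (u ` {T..})"
      by (intro connected_continuous_image continuous_on_subset[OF u]) (auto simp: T_def)
    have "dist (u t) e < \<epsilon>" if "t \<ge> T" for t
    proof (rule ccontr)
      assume "\<not> dist (u t) e < \<epsilon>"
      then have "u ` {T..} - ball e \<epsilon> \<noteq> {}" using that by (auto simp: dist_commute)
      moreover have "u ` {T..} \<inter> ball e \<epsilon> \<noteq> {}" using s by (auto simp: dist_commute)
      ultimately have "u ` {T..} \<inter> frontier (ball e \<epsilon>) \<noteq> {}"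
        using connected_Int_frontier[OF conn] by blast
      then show False using T0 \<epsilon> by (auto simp: T_def)
    qed
    then show "\<forall>\<^sub>F t in at_top. dist (u t) e < \<epsilon>'"
      unfolding eventually_at_top_linorder using \<epsilon>(3) by (meson less_le_trans)
  qed
  with fe show ?thesis by blast
qed


section \<open>Quadratic forms and growth of antiderivatives\<close>

lemma inner_matrix_vector_mult: "x \<bullet> (A *v y) = (transpose A *v x) \<bullet> y"
  for A :: "real^'n^'m"
  by (metis dot_lmul_matrix transpose_matrix_vector)

lemma diag_mult_vec_nth [simp]: "(diag d *v x) $ i = d i * x $ i"
  by (simp add: diag_def matrix_vector_mult_def if_distrib[of "\<lambda>y. y * _"] cong: if_cong)

lemma inner_diag_mult_vec: "x \<bullet> (diag d *v y) = (\<Sum>i\<in>UNIV. d i * x $ i * y $ i)"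
  by (simp add: inner_vec_def mult_ac)

text \<open>Scaling by square roots turns a weighted energy form into the Euclidean inner product,
  to which Cauchy-Schwarz and the spectral norm apply.\<close>

lemma inner_scaled_vec:
  assumes "\<And>i. 0 \<le> d i"
  shows "(diag (\<lambda>i. sqrt (d i)) *v x) \<bullet> (diag (\<lambda>i. sqrt (d i)) *v y) = x \<bullet> (diag d *v y)"
proof -
  have "sqrt (d i) * x $ i * (sqrt (d i) * y $ i) = d i * x $ i * y $ i" for i
    using real_sqrt_mult_self[of "d i"] assms[of i]
    by (metis abs_of_nonneg mult.assoc mult.left_commute)
  then show ?thesis
    unfolding inner_diag_mult_vec inner_vec_def by (intro sum.cong refl) simp
qed

lemma inner_diag_lower_bound:
  fixes d :: "'n::finite \<Rightarrow> real"
  assumes "\<And>i. 0 < d i"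
  shows "\<exists>c>0. \<forall>x. c * (norm x)\<^sup>2 \<le> x \<bullet> (diag d *v x)"
proof (intro exI conjI allI)
  show "0 < Min (range d)" using assms by simp
  show "Min (range d) * (norm x)\<^sup>2 \<le> x \<bullet> (diag d *v x)" for x
    unfolding power2_norm_eq_inner inner_vec_def[of x x] inner_diag_mult_vec sum_distrib_left
    by (intro sum_mono) (simp add: mult.assoc mult_right_mono)
qed

section \<open>Rayleigh quotients and least eigenvalues\<close>

lemma nonneg_quadratic_imp_linear_coeff_0:
  fixes a b :: real
  assumes "\<And>t. 0 \<le> 2 * t * a + t\<^sup>2 * b"
  shows "a = 0"
proof (rule ccontr)
  assume "a \<noteq> 0"
  have "b \<ge> 0" using assms[of 1] assms[of "-1"] by simp
  \<comment> \<open>A small step against the sign of \<open>a\<close> makes the expression negative;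
    \<open>b + 1\<close> in place of \<open>b\<close> avoids a zero denominator.\<close>
  define t where "t = - a / (b + 1)"
  have t: "t * (b + 1) = - a" using \<open>b \<ge> 0\<close> by (simp add: t_def)
  have "2 * t * a + t\<^sup>2 * b = - t\<^sup>2 * (b + 2)"
    using t by algebra
  moreover have "t \<noteq> 0" using t \<open>a \<noteq> 0\<close> by auto
  ultimately show False using assms[of t] \<open>b \<ge> 0\<close>
    by (smt (verit) mult_pos_pos mult_minus_left zero_less_power2)
qed

text \<open>The Rayleigh quotient attains its minimum on the compact unit sphere, and a minimiser is
  an eigenvector by the first-order condition.\<close>

lemma symmetric_matrix_min_eigenvalue:
  fixes M :: "real^'n^'n"
  assumes sym: "transpose M = M"
  shows "\<exists>k v. v \<noteq> 0 \<and> M *v v = k *\<^sub>R v \<and> (\<forall>x. k * (norm x)\<^sup>2 \<le> x \<bullet> (M *v x))"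
proof -
  have "continuous_on (sphere 0 1) (\<lambda>x. x \<bullet> (M *v x))"
    by (intro continuous_intros)
  then obtain v where v: "norm v = 1"
    and min: "\<And>y. norm y = 1 \<Longrightarrow> v \<bullet> (M *v v) \<le> y \<bullet> (M *v y)"
    using continuous_attains_inf[OF compact_sphere, of "0::real^'n" 1 "\<lambda>x. x \<bullet> (M *v x)"]
    by (auto simp: sphere_eq_empty)
  define k where "k = v \<bullet> (M *v v)"
  have le: "k * (norm x)\<^sup>2 \<le> x \<bullet> (M *v x)" for x
  proof (cases "x = 0")
    case False
    have "k \<le> (x /\<^sub>R norm x) \<bullet> (M *v (x /\<^sub>R norm x))"
      unfolding k_def by (rule min) (simp add: False)
    also have "\<dots> = x \<bullet> (M *v x) / (norm x)\<^sup>2"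
      by (simp add: matrix_vector_mult_scaleR power2_eq_square divide_simps)
    finally show ?thesis using False by (simp add: field_simps)
  qed simp
  \<comment> \<open>The residual of the eigenvalue equation. The form
    \<open>x \<bullet> (M *v x) - k * (norm x)\<^sup>2\<close> is nonnegative and vanishes at
    \<open>v\<close>; along \<open>v + t *\<^sub>R w\<close> its linear term is
    \<open>2 * t * (w \<bullet> w)\<close>, which therefore must vanish.\<close>
  define w where "w = M *v v - k *\<^sub>R v"
  have "w \<bullet> w = 0"
  proof (rule nonneg_quadratic_imp_linear_coeff_0)
    fix t :: real
    have "(v + t *\<^sub>R w) \<bullet> (M *v (v + t *\<^sub>R w)) - k * (norm (v + t *\<^sub>R w))\<^sup>2
        = v \<bullet> (M *v v) - k * (v \<bullet> v) + t * (v \<bullet> (M *v w) + w \<bullet> (M *v v) - 2 * k * (v \<bullet> w))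
          + t\<^sup>2 * (w \<bullet> (M *v w) - k * (w \<bullet> w))"
      unfolding power2_norm_eq_inner
      by (simp add: matrix_vector_mult_scaleR algebra_simps inner_add_left inner_add_right
          inner_commute power2_eq_square)
    also have "v \<bullet> (M *v v) - k * (v \<bullet> v) = 0"
      using v by (simp add: k_def flip: power2_norm_eq_inner)
    also have "v \<bullet> (M *v w) = w \<bullet> (M *v v)"
      using inner_matrix_vector_mult[of v M w] sym by (simp add: inner_commute)
    also have "w \<bullet> (M *v v) + w \<bullet> (M *v v) - 2 * k * (v \<bullet> w) = 2 * (w \<bullet> w)"
      unfolding w_def by (simp add: inner_diff_right inner_diff_left inner_commute algebra_simps)
    finally show "0 \<le> 2 * t * (w \<bullet> w) + t\<^sup>2 * (w \<bullet> (M *v w) - k * (w \<bullet> w))"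
      using le[of "v + t *\<^sub>R w"] by (simp add: mult_ac)
  qed
  then have "M *v v = k *\<^sub>R v" by (simp add: w_def)
  moreover have "v \<noteq> 0" using v by auto
  ultimately show ?thesis using le by blast
qed

text \<open>\<open>LEAST\<close> over the reals is meaningful only if a minimum exists. The Rayleigh
  minimum supplies it, since every eigenvalue is the Rayleigh quotient of its eigenvector.\<close>

lemma least_eigenvalue_le_quadratic_form:
  fixes M :: "real^'n^'n"
  assumes "transpose M = M"
  shows "least_eigenvalue M * (norm x)\<^sup>2 \<le> x \<bullet> (M *v x)"
proof -
  obtain k v where kv: "v \<noteq> 0" "M *v v = k *\<^sub>R v"
    and k: "\<And>x. k * (norm x)\<^sup>2 \<le> x \<bullet> (M *v x)"
    using symmetric_matrix_min_eigenvalue[OF assms] by blast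
  have "least_eigenvalue M = k"
    unfolding least_eigenvalue_def
  proof (rule Least_equality)
    show "\<exists>v. v \<noteq> 0 \<and> M *v v = k *\<^sub>R v" by (intro exI[of _ v] conjI kv)
    show "k \<le> l" if "\<exists>v. v \<noteq> 0 \<and> M *v v = l *\<^sub>R v" (is ?eigen) for l
    proof -
      obtain w where w: "w \<noteq> 0" "M *v w = l *\<^sub>R w" using \<open>?eigen\<close> by auto
      then have "k * (norm w)\<^sup>2 \<le> l * (norm w)\<^sup>2"
        using k[of w] by (simp add: power2_norm_eq_inner)
      then show ?thesis using w(1) by simp
    qed
  qed
  then show ?thesis using k by simp
qed

text \<open>The constant is the minimal Rayleigh quotient, positive because it is attained at an
  eigenvector.\<close>

lemma positive_definite_lower_bound:
  assumes "positive_definite M"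
  shows "\<exists>c>0. \<forall>x. c * (norm x)\<^sup>2 \<le> x \<bullet> (M *v x)"
proof -
  obtain k v where kv: "v \<noteq> 0" "M *v v = k *\<^sub>R v"
    and k: "\<And>x. k * (norm x)\<^sup>2 \<le> x \<bullet> (M *v x)"
    using symmetric_matrix_min_eigenvalue assms unfolding positive_definite_def by blast
  have "0 < v \<bullet> (M *v v)" using assms kv(1) by (simp add: positive_definite_def)
  also have "\<dots> = k * (norm v)\<^sup>2" by (simp add: kv(2) power2_norm_eq_inner)
  finally have "k > 0" by (simp add: zero_less_mult_iff)
  with k show ?thesis by blast
qed

lemma positive_definite_mult_matrix_inv:
  assumes "positive_definite M"
  shows "M ** matrix_inv M = mat 1"
proof -
  have "x = 0" if "M *v x = 0" for x
    using that assms by (metis inner_zero_right less_irrefl positive_definite_def)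
  then have "invertible M"
    using matrix_left_invertible_ker invertible_left_inverse by blast
  then show ?thesis
    unfolding invertible_def matrix_inv_def by (rule someI2_ex) simp
qed

lemma norm_matrix_le_spectral_norm: "norm (M *v x) \<le> spectral_norm M * norm x"
  unfolding spectral_norm_def by (rule onorm) (rule matrix_vector_mul_bounded_linear)

section \<open>Quadratic growth of antiderivatives\<close>

lemma antiderivative_real:
  fixes f :: "real \<Rightarrow> real"
  assumes "continuous_on UNIV f"
  shows "\<exists>F. \<forall>x. (F has_real_derivative f x) (at x)"
proof -
  have "isCont f x" for x using assms by (simp add: continuous_on_eq_continuous_at)
  then show ?thesis
    using einterval_antiderivative[of "-\<infinity>" "\<infinity>" f]
    by (auto simp: has_real_derivative_iff_has_vector_derivative)
qed

text \<open>On each half-line the difference of \<open>F\<close> and the antiderivative of the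
  affine bound of \<open>f\<close> is monotone; compare it with its value at 0.\<close>

lemma antiderivative_quadratic_growth:
  fixes F f :: "real \<Rightarrow> real"
  assumes F: "\<And>x. (F has_real_derivative f x) (at x)"
    and pos: "\<And>x. 0 \<le> x \<Longrightarrow> g * x - d \<le> f x"
    and neg: "\<And>x. x \<le> 0 \<Longrightarrow> f x \<le> g * x + d"
  shows "F 0 + g / 2 * x\<^sup>2 - d * \<bar>x\<bar> \<le> F x"
proof (cases "x \<ge> 0")
  case True
  have "F 0 - (g / 2 * 0\<^sup>2 - d * 0) \<le> F x - (g / 2 * x\<^sup>2 - d * x)"
  proof (rule DERIV_nonneg_imp_nondecreasing[OF True])
    fix y :: real assume "0 \<le> y"
    then show "\<exists>z. ((\<lambda>x. F x - (g / 2 * x\<^sup>2 - d * x)) has_real_derivative z) (at y) \<and> 0 \<le> z"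
      using pos[of y] by (intro exI[of _ "f y - (g * y - d)"])
        (auto intro!: derivative_eq_intros F)
  qed
  with True show ?thesis by simp
next
  case False
  then have x: "x \<le> 0" by simp
  have "F x - (g / 2 * x\<^sup>2 + d * x) \<ge> F 0 - (g / 2 * 0\<^sup>2 + d * 0)"
  proof (rule DERIV_nonpos_imp_nonincreasing[OF x])
    fix y :: real assume "y \<le> 0"
    then show "\<exists>z. ((\<lambda>x. F x - (g / 2 * x\<^sup>2 + d * x)) has_real_derivative z) (at y) \<and> z \<le> 0"
      using neg[of y] by (intro exI[of _ "f y - (g * y + d)"])
        (auto intro!: derivative_eq_intros F)
  qed
  with x show ?thesis by simp
qed

lemma quadratic_lower_bound:
  fixes c b x :: real
  assumes "0 < c"
  shows "c / 2 * x\<^sup>2 - b\<^sup>2 / (2 * c) \<le> c * x\<^sup>2 + b * x"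
proof -
  have "c * x\<^sup>2 + b * x - (c / 2 * x\<^sup>2 - b\<^sup>2 / (2 * c)) = (c * x + b)\<^sup>2 / (2 * c)"
    using assms by (simp add: field_simps power2_eq_square)
  also have "\<dots> \<ge> 0" using assms by simp
  finally show ?thesis by simp
qed

text \<open>The shift \<open>w\<close> and the term \<open>a * x\<close> contribute only linear and
  constant terms, and the surplus \<open>g - h\<close> of quadratic growth absorbs the linear ones
  at the cost of a constant.\<close>

lemma shifted_antiderivative_quadratic_growth:
  fixes F f :: "real \<Rightarrow> real"
  assumes F: "\<And>x. (F has_real_derivative f x) (at x)"
    and pos: "\<And>x. 0 \<le> x \<Longrightarrow> g * x - d \<le> f x"
    and neg: "\<And>x. x \<le> 0 \<Longrightarrow> f x \<le> g * x + d"
    and "h < g"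
  shows "\<exists>e. \<forall>x. h / 2 * x\<^sup>2 - e \<le> F (x + w) - a * x"
proof (intro exI allI)
  fix x
  define y where "y = x + w"
  \<comment> \<open>With \<open>x = y - w\<close> the quadratic surplus is
    \<open>c * y\<^sup>2\<close>, and \<open>b * \<bar>y\<bar>\<close> dominates all linear
    terms.\<close>
  define c where "c = (g - h) / 2"
  define b where "b = d + \<bar>a - h * w\<bar>"
  have "c > 0" using \<open>h < g\<close> by (simp add: c_def)
  then have "- (b\<^sup>2 / (2 * c)) \<le> c * y\<^sup>2 - b * \<bar>y\<bar>"
    using quadratic_lower_bound[of c "\<bar>y\<bar>" "- b"] by (smt (verit) mult_minus_left mult_nonneg_nonneg
        power2_abs power2_minus divide_nonneg_pos zero_le_power2)
  also have "\<dots> \<le> c * y\<^sup>2 - d * \<bar>y\<bar> - (a - h * w) * y"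
  proof -
    have "(a - h * w) * y \<le> \<bar>a - h * w\<bar> * \<bar>y\<bar>" by (metis abs_ge_self abs_mult)
    then show ?thesis by (simp add: b_def distrib_right)
  qed
  also have "\<dots> \<le> F y - F 0 - h / 2 * y\<^sup>2 - (a - h * w) * y"
    using antiderivative_quadratic_growth[OF F pos neg, of y] by (simp add: c_def field_simps)
  also have "\<dots> = F (x + w) - a * x - h / 2 * x\<^sup>2 - F 0 - a * w + h / 2 * w\<^sup>2"
    by (simp add: y_def field_simps power2_eq_square)
  finally show "h / 2 * x\<^sup>2 - (b\<^sup>2 / (2 * c) - F 0 - a * w + h / 2 * w\<^sup>2) \<le> F (x + w) - a * x"
    by simp
qed


section \<open>The Lyapunov function\<close>

lemma quadratic_form_has_real_derivative:
  fixes M :: "real^'n^'n"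
  assumes sym: "transpose M = M" and u: "(u has_vector_derivative u') (at t within I)"
  shows "((\<lambda>t. u t \<bullet> (M *v u t) / 2) has_real_derivative u' \<bullet> (M *v u t)) (at t within I)"
proof -
  have Mu: "((\<lambda>t. M *v u t) has_vector_derivative M *v u') (at t within I)"
    by (rule bounded_linear.has_vector_derivative[OF matrix_vector_mul_bounded_linear u])
  have "((\<lambda>t. u t \<bullet> (M *v u t)) has_real_derivative u t \<bullet> (M *v u') + u' \<bullet> (M *v u t)) (at t within I)"
    unfolding has_real_derivative_iff_has_vector_derivative
    by (rule bounded_bilinear.has_vector_derivative[OF bounded_bilinear_inner u Mu])
  moreover have "u t \<bullet> (M *v u') = u' \<bullet> (M *v u t)"
    using inner_matrix_vector_mult[of "u t" M u'] sym by (simp add: inner_commute)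
  ultimately show ?thesis by (auto intro: derivative_eq_intros)
qed

text \<open>
  The system \<open>C x' = - P x - N y - g x\<close>, \<open>L y' = N\<^sup>T x - B y + B s\<close> with \<open>B S = N\<^sup>T\<close>, so that
  \<open>S x + s\<close> is the equilibrium of the second equation for frozen \<open>x\<close>.
\<close>

locale mixed_potential_system =
  fixes P :: "real^'c^'c" and N :: "real^'l^'c" and B :: "real^'l^'l"
    and S :: "real^'c^'l" and s :: "real^'l" and C :: "'c \<Rightarrow> real" and L :: "'l \<Rightarrow> real"
    and g J :: "'c \<Rightarrow> real \<Rightarrow> real" and k \<kappa> d :: real
  assumes P_sym: "transpose P = P"
    and B_pos: "positive_definite B"
    and B_S: "B ** S = transpose N"
    and C_pos: "\<And>i. 0 < C i" and L_pos: "\<And>j. 0 < L j"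
    and g_cont: "\<And>i. continuous_on UNIV (g i)"
    and J_deriv: "\<And>i x. (J i has_real_derivative g i x) (at x)"
    and contraction:
      "\<And>v. norm (diag (\<lambda>j. sqrt (L j)) *v (S *v (diag (\<lambda>i. 1 / sqrt (C i)) *v v))) \<le> k * norm v"
    and k_nonneg: "0 \<le> k" and k_less_1: "k < 1"
    and \<kappa>_pos: "\<kappa> > 0"
    and coercive: "\<And>x. \<kappa> * (norm x)\<^sup>2 - d \<le> x \<bullet> (P *v x) / 2 + (\<Sum>i\<in>UNIV. J i (x $ i))"
begin

lemma B_sym: "transpose B = B"
  using B_pos by (simp add: positive_definite_def)

section \<open>Vector field and Lyapunov function\<close>

definition G :: "real^'c \<Rightarrow> real^'c" where
  "G x = (\<chi> i. g i (x $ i))"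

definition offset :: "real^'c \<Rightarrow> real^'l \<Rightarrow> real^'l" where
  "offset x y = y - (S *v x + s)"

definition rhs_x :: "real^'c \<Rightarrow> real^'l \<Rightarrow> real^'c" where
  "rhs_x x y = - (P *v x) - N *v y - G x"

definition rhs_y :: "real^'c \<Rightarrow> real^'l \<Rightarrow> real^'l" where
  "rhs_y x y = transpose N *v x - B *v y + B *v s"

definition field :: "(real^'c) \<times> (real^'l) \<Rightarrow> (real^'c) \<times> (real^'l)" where
  "field = (\<lambda>(x, y). (\<chi> i. rhs_x x y $ i / C i, \<chi> j. rhs_y x y $ j / L j))"

text \<open>Symmetry of \<open>B\<close> and \<open>B ** S = transpose N\<close> give
  \<open>transpose S ** B = N\<close>, so the third term is a potential of
  \<open>N *v (S *v x + s)\<close>. The first three terms thus form the potential of the x-equation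
  with \<open>y\<close> relaxed to its frozen equilibrium; the last measures the deviation from
  it.\<close>

definition V :: "(real^'c) \<times> (real^'l) \<Rightarrow> real" where
  "V = (\<lambda>(x, y). x \<bullet> (P *v x) / 2 + (\<Sum>i\<in>UNIV. J i (x $ i))
     + (S *v x + s) \<bullet> (B *v (S *v x + s)) / 2 + offset x y \<bullet> (B *v offset x y) / 2)"

lemma B_S_mult: "B *v (S *v x) = transpose N *v x"
  by (simp add: B_S matrix_vector_mul_assoc)

lemma rhs_y_eq: "rhs_y x y = - (B *v offset x y)"
  by (simp add: rhs_y_def offset_def matrix_vector_mult_diff_distrib matrix_vector_right_distrib B_S_mult)

lemma field_eq_iff:
  "field (x, y) = (x', y') \<longleftrightarrow> diag C *v x' = rhs_x x y \<and> diag L *v y' = rhs_y x y"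
proof -
  have "C i \<noteq> 0" "L j \<noteq> 0" for i j
    using C_pos[of i] L_pos[of j] by auto
  then show ?thesis by (auto simp: field_def vec_eq_iff nonzero_divide_eq_eq mult.commute)
qed

lemma continuous_field: "continuous_on UNIV field"
proof -
  have "continuous_on UNIV (\<lambda>p::(real^'c) \<times> (real^'l). g i (fst p $ i))" for i
    by (rule continuous_on_compose2[OF g_cont]) (auto intro!: continuous_intros)
  then have "continuous_on UNIV (\<lambda>p::(real^'c) \<times> (real^'l). G (fst p))"
    unfolding G_def by (intro continuous_on_vec_lambda)
  then have "continuous_on UNIV (\<lambda>p. (\<chi> i. rhs_x (fst p) (snd p) $ i / C i, \<chi> j. rhs_y (fst p) (snd p) $ j / L j))"
    unfolding rhs_x_def rhs_y_def divide_inverse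
    by (intro continuous_intros continuous_on_vec_lambda
        bounded_linear.continuous_on[OF matrix_vector_mul_bounded_linear])
  then show ?thesis by (simp add: field_def case_prod_unfold)
qed

text \<open>Coercivity bounds \<open>x\<close>, definiteness of \<open>B\<close> bounds the offset,
  and \<open>y\<close> is the offset plus an affine image of \<open>x\<close>.\<close>

lemma bounded_sublevel: "bounded {p. V p \<le> a}"
proof -
  obtain b where b: "b > 0" "\<And>z. b * (norm z)\<^sup>2 \<le> z \<bullet> (B *v z)"
    using positive_definite_lower_bound[OF B_pos] by blast
  define \<rho> where "\<rho> = sqrt ((a + d) / \<kappa>)"
  define \<sigma> where "\<sigma> = sqrt (2 * (a + d) / b)"
  have "norm (x, y) \<le> \<rho> + (\<sigma> + (spectral_norm S * \<rho> + norm s))" if V: "V (x, y) \<le> a" for x y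
  proof -
    have nonneg: "0 \<le> z \<bullet> (B *v z)" for z
      using b(2)[of z] b(1) by (smt (verit) mult_nonneg_nonneg zero_le_power2)
    let ?z = "offset x y"
    \<comment> \<open>The third term of \<open>V\<close> is nonnegative and is dropped.\<close>
    have sum: "\<kappa> * (norm x)\<^sup>2 + ?z \<bullet> (B *v ?z) / 2 \<le> a + d"
      using V coercive[of x] nonneg[of "S *v x + s"] by (simp add: V_def)
    then have "(norm x)\<^sup>2 \<le> (a + d) / \<kappa>"
      using nonneg[of ?z] \<kappa>_pos by (simp add: pos_le_divide_eq mult.commute)
    then have x: "norm x \<le> \<rho>" unfolding \<rho>_def by (rule real_le_rsqrt)
    have "0 \<le> \<kappa> * (norm x)\<^sup>2" using \<kappa>_pos by simp
    then have "(norm ?z)\<^sup>2 \<le> 2 * (a + d) / b"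
      using sum b(2)[of ?z] b(1) by (simp add: pos_le_divide_eq mult.commute)
    then have z: "norm ?z \<le> \<sigma>" unfolding \<sigma>_def by (rule real_le_rsqrt)
    have "0 \<le> spectral_norm S"
      unfolding spectral_norm_def by (rule onorm_pos_le) (rule matrix_vector_mul_bounded_linear)
    then have "norm (S *v x) \<le> spectral_norm S * \<rho>"
      using norm_matrix_le_spectral_norm[of S x] x by (meson mult_left_mono order_trans)
    moreover have "norm y \<le> norm ?z + (norm (S *v x) + norm s)"
      using norm_triangle_ineq[of ?z "S *v x + s"] norm_triangle_ineq[of "S *v x" s]
      by (simp add: offset_def)
    ultimately show ?thesis using norm_Pair_le[of x y] x z by linarith
  qed
  then show ?thesis unfolding bounded_iff by auto
qed

lemma V_lower_bound: "- d \<le> V p"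
proof -
  obtain x y where p: "p = (x, y)" by fastforce
  have "0 \<le> z \<bullet> (B *v z)" for z
    using B_pos by (cases "z = 0") (auto simp: positive_definite_def less_imp_le)
  moreover have "0 \<le> \<kappa> * (norm x)\<^sup>2" using \<kappa>_pos by simp
  ultimately show ?thesis
    using coercive[of x] by (simp add: V_def p) (smt (verit) divide_nonneg_pos)
qed

section \<open>Dissipation along solutions\<close>

lemma V_has_real_derivative:
  assumes x: "(x has_vector_derivative x') (at t within I)"
    and y: "(y has_vector_derivative y') (at t within I)"
  shows "((\<lambda>t. V (x t, y t)) has_real_derivative
      x' \<bullet> (P *v x t + G (x t) + N *v (S *v x t + s))
      + (y' - S *v x') \<bullet> (B *v offset (x t) (y t))) (at t within I)"
proof -
  have Sx: "((\<lambda>t. S *v x t + s) has_vector_derivative S *v x') (at t within I)"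
    using bounded_linear.has_vector_derivative[OF matrix_vector_mul_bounded_linear[of S] x]
    by (simp add: has_vector_derivative_add_const)
  have off: "((\<lambda>t. offset (x t) (y t)) has_vector_derivative y' - S *v x') (at t within I)"
    unfolding offset_def by (rule has_vector_derivative_diff[OF y Sx])
  have "((\<lambda>t. J i (x t $ i)) has_real_derivative g i (x t $ i) * x' $ i) (at t within I)" for i
  proof -
    have "((\<lambda>t. x t $ i) has_real_derivative x' $ i) (at t within I)"
      unfolding has_real_derivative_iff_has_vector_derivative
      by (rule bounded_linear.has_vector_derivative[OF bounded_linear_vec_nth x])
    then show ?thesis by (rule DERIV_chain2[OF J_deriv])
  qed
  then have "((\<lambda>t. \<Sum>i\<in>UNIV. J i (x t $ i)) has_real_derivative (\<Sum>i\<in>UNIV. g i (x t $ i) * x' $ i))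
      (at t within I)"
    by (rule DERIV_sum)
  moreover have "(\<Sum>i\<in>UNIV. g i (x t $ i) * x' $ i) = x' \<bullet> G (x t)"
    by (simp add: inner_vec_def G_def mult.commute)
  ultimately have "((\<lambda>t. V (x t, y t)) has_real_derivative
      x' \<bullet> (P *v x t) + x' \<bullet> G (x t) + (S *v x') \<bullet> (B *v (S *v x t + s))
      + (y' - S *v x') \<bullet> (B *v offset (x t) (y t))) (at t within I)"
    unfolding V_def prod.case
    by (intro DERIV_add quadratic_form_has_real_derivative P_sym B_sym x Sx off) simp
  \<comment> \<open>The identity \<open>transpose S ** B = N\<close> moves \<open>S\<close> off
    \<open>x'\<close>, so this term joins the other factors of \<open>x'\<close>.\<close>
  moreover have "(S *v x') \<bullet> (B *v (S *v x t + s)) = x' \<bullet> (N *v (S *v x t + s))"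
    by (simp add: inner_matrix_vector_mult B_sym B_S_mult)
  ultimately show ?thesis by (simp add: inner_add_right)
qed

text \<open>The derivative of \<open>V\<close> as a function of the velocity alone: the arguments
  are the components of \<open>field\<close>, not the state.\<close>

definition V_dot :: "(real^'c) \<times> (real^'l) \<Rightarrow> real" where
  "V_dot = (\<lambda>(x', y'). - (x' \<bullet> (diag C *v x')) - y' \<bullet> (diag L *v y')
     + 2 * ((S *v x') \<bullet> (diag L *v y')))"

lemma V_derivative_along_field:
  assumes u: "(u has_vector_derivative field (u t)) (at t within I)"
  shows "((\<lambda>t. V (u t)) has_real_derivative V_dot (field (u t))) (at t within I)"
proof -
  obtain x' y' where f: "field (u t) = (x', y')" by fastforce
  define x y where "x = fst \<circ> u" and "y = snd \<circ> u"
  have xy: "u t = (x t, y t)" for t by (simp add: x_def y_def)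
  have x: "(x has_vector_derivative x') (at t within I)"
    using bounded_linear.has_vector_derivative[OF bounded_linear_fst u] by (simp add: x_def f o_def)
  have y: "(y has_vector_derivative y') (at t within I)"
    using bounded_linear.has_vector_derivative[OF bounded_linear_snd u] by (simp add: y_def f o_def)
  let ?z = "offset (x t) (y t)"
  have Cx: "diag C *v x' = rhs_x (x t) (y t)" and Ly: "diag L *v y' = - (B *v ?z)"
    using f by (auto simp: field_eq_iff xy rhs_y_eq)
  have "P *v x t + G (x t) + N *v (S *v x t + s) = - (diag C *v x') - N *v ?z"
    unfolding Cx by (simp add: rhs_x_def offset_def matrix_vector_mult_diff_distrib)
  moreover have "x' \<bullet> (N *v ?z) = (S *v x') \<bullet> (B *v ?z)"
    by (simp add: inner_matrix_vector_mult B_sym B_S_mult)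
  ultimately show ?thesis
    using V_has_real_derivative[OF x y] Ly unfolding f
    by (simp add: V_dot_def xy inner_diff_right inner_diff_left)
qed

text \<open>In the scaled variables \<open>p\<close>, \<open>r\<close> the contraction bounds the
  mixed term by \<open>2 * k * norm p * norm r\<close>; the inequality of arithmetic and geometric
  means then leaves the fraction \<open>1 - k\<close> of the diagonal terms.\<close>

lemma dissipation_estimate:
  "V_dot (x, y) \<le> - (1 - k) * (x \<bullet> (diag C *v x) + y \<bullet> (diag L *v y))"
proof -
  define p where "p = diag (\<lambda>i. sqrt (C i)) *v x"
  define r where "r = diag (\<lambda>j. sqrt (L j)) *v y"
  have C0: "0 \<le> C i" and L0: "0 \<le> L j" for i j using C_pos L_pos by (auto simp: less_imp_le)
  have p: "(norm p)\<^sup>2 = x \<bullet> (diag C *v x)" and r: "(norm r)\<^sup>2 = y \<bullet> (diag L *v y)"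
    by (simp_all add: power2_norm_eq_inner p_def r_def inner_scaled_vec C0 L0)
  have "1 / sqrt (C i) * (sqrt (C i) * a) = a" for i a using C_pos[of i] by simp
  then have x: "diag (\<lambda>i. 1 / sqrt (C i)) *v p = x" by (simp add: p_def vec_eq_iff)
  have "(S *v x) \<bullet> (diag L *v y) = (diag (\<lambda>j. sqrt (L j)) *v (S *v x)) \<bullet> r"
    by (simp add: r_def inner_scaled_vec L0)
  also have "\<dots> \<le> norm (diag (\<lambda>j. sqrt (L j)) *v (S *v x)) * norm r"
    by (rule norm_cauchy_schwarz)
  also have "\<dots> \<le> (k * norm p) * norm r"
    using contraction[of p] by (simp add: x mult_right_mono)
  finally have le: "(S *v x) \<bullet> (diag L *v y) \<le> k * (norm p * norm r)" by (simp add: mult.assoc)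
  have amgm: "2 * (norm p * norm r) \<le> (norm p)\<^sup>2 + (norm r)\<^sup>2"
    using sum_squares_bound[of "norm p" "norm r"] by simp
  have "k * (2 * (norm p * norm r)) \<le> k * ((norm p)\<^sup>2 + (norm r)\<^sup>2)"
    using amgm k_nonneg by (rule mult_left_mono)
  with le show ?thesis by (simp add: V_dot_def algebra_simps flip: p r)
qed

lemma V_dot_upper_bound: "\<exists>c>0. \<forall>p. V_dot p \<le> - c * (norm p)\<^sup>2"
proof -
  obtain a where a: "a > 0" "\<And>x. a * (norm x)\<^sup>2 \<le> x \<bullet> (diag C *v x)"
    using inner_diag_lower_bound[of C] C_pos by blast
  obtain b where b: "b > 0" "\<And>y. b * (norm y)\<^sup>2 \<le> y \<bullet> (diag L *v y)"
    using inner_diag_lower_bound[of L] L_pos by blast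
  show ?thesis
  proof (intro exI conjI allI)
    show "0 < (1 - k) * min a b" using a(1) b(1) k_less_1 by simp
    fix p :: "(real^'c) \<times> (real^'l)"
    obtain x y where p: "p = (x, y)" by fastforce
    have "(norm p)\<^sup>2 = (norm x)\<^sup>2 + (norm y)\<^sup>2" by (simp add: p power2_norm_eq_inner)
    then have "min a b * (norm p)\<^sup>2 = min a b * (norm x)\<^sup>2 + min a b * (norm y)\<^sup>2"
      by (simp only: distrib_left)
    also have "\<dots> \<le> a * (norm x)\<^sup>2 + b * (norm y)\<^sup>2"
      by (intro add_mono mult_right_mono) auto
    also have "\<dots> \<le> x \<bullet> (diag C *v x) + y \<bullet> (diag L *v y)"
      by (intro add_mono a b)
    finally have "(1 - k) * (min a b * (norm p)\<^sup>2) \<le> (1 - k) * (x \<bullet> (diag C *v x) + y \<bullet> (diag L *v y))"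
      using k_less_1 by (intro mult_left_mono) auto
    then show "V_dot p \<le> - ((1 - k) * min a b) * (norm p)\<^sup>2"
      using dissipation_estimate[of x y] unfolding p mult_minus_left mult.assoc by linarith
  qed
qed

section \<open>Boundedness and vanishing velocity\<close>

lemma bounded_solution:
  assumes I: "is_interval I" "0 \<in> I" "I \<subseteq> {0..}"
    and u: "\<And>t. t \<in> I \<Longrightarrow> (u has_vector_derivative field (u t)) (at t within I)"
  shows "bounded (u ` I)"
proof -
  obtain c where c: "c > 0" "\<And>p. V_dot p \<le> - c * (norm p)\<^sup>2"
    using V_dot_upper_bound by blast
  \<comment> \<open>As \<open>V\<close> cannot increase, the orbit stays in one bounded sublevel
    set. Only \<open>{0..t}\<close> enters, so solutions of finite lifetime are covered.\<close>
  have "V (u t) \<le> V (u 0)" if "t \<in> I" for t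
  proof (cases "t = 0")
    case False
    then have "0 < t" using subsetD[OF I(3) that] by simp
    have sub: "{0..t} \<subseteq> I" using mem_is_interval_1_I[OF I(1,2) that] by auto
    have "\<exists>\<xi>\<in>{0<..<t}. V (u t) - V (u 0) = V_dot (field (u \<xi>)) * (t - 0)"
    proof (rule mvt_simple[where f' = "\<lambda>x h. V_dot (field (u x)) * h", OF \<open>0 < t\<close>])
      show "((\<lambda>t. V (u t)) has_derivative (\<lambda>h. V_dot (field (u x)) * h)) (at x within {0..t})"
        if "0 \<le> x" "x \<le> t" for x
      proof -
        have "x \<in> I" using sub that by auto
        then have "((\<lambda>t. V (u t)) has_derivative (\<lambda>h. V_dot (field (u x)) * h)) (at x within I)"
          using V_derivative_along_field[OF u] by (simp add: has_field_derivative_def)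
        then show ?thesis by (rule has_derivative_subset[OF _ sub])
      qed
    qed
    moreover have "V_dot p \<le> 0" for p
      using c(2)[of p] c(1) by (smt (verit) mult_minus_left mult_nonneg_nonneg zero_le_power2)
    ultimately show ?thesis using \<open>0 < t\<close> by (smt (verit) mult_nonpos_nonneg)
  qed simp
  then show ?thesis by (intro bounded_subset[OF bounded_sublevel[of "V (u 0)"]]) auto
qed

lemma field_tendsto_0:
  assumes u: "\<And>t. t \<ge> 0 \<Longrightarrow> (u has_vector_derivative field (u t)) (at t within {0..})"
  shows "((\<lambda>t. field (u t)) \<longlongrightarrow> 0) at_top"
proof -
  obtain c where c: "c > 0" "\<And>p. V_dot p \<le> - c * (norm p)\<^sup>2"
    using V_dot_upper_bound by blast
  have "bounded (u ` {0..})" using u by (intro bounded_solution is_interval_ci) auto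
  then show ?thesis
    using u V_derivative_along_field[OF u] c V_lower_bound
    by (intro dissipation_imp_velocity_tendsto_0[OF continuous_field,
          where v = "\<lambda>t. V (u t)" and D = "\<lambda>t. V_dot (field (u t))" and m = "- d"]) auto
qed

end


section \<open>The state equations of the circuit\<close>

lemma sum_UNIV_sum_type:
  "(\<Sum>a\<in>UNIV. f a) = (\<Sum>i\<in>UNIV. f (Inl i)) + (\<Sum>j\<in>UNIV. f (Inr j))"
  for f :: "'a::finite + 'b::finite \<Rightarrow> 'm::comm_monoid_add"
  by (subst UNIV_Plus_UNIV[symmetric], subst sum.Plus) simp_all

lemma stack_eq_iff: "stack u w = stack u' w' \<longleftrightarrow> u = u' \<and> w = w'"
  by (auto simp: stack_def vec_eq_iff split: sum.splits)

lemma H_matrix_mult_stack: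
  "H_matrix G RT RL R *v stack x y
    = stack (H_alpha_alpha G RT RL R *v x + H_alpha_beta G RT *v y)
            (H_beta_beta G RT R *v y - transpose (H_alpha_beta G RT) *v x)"
  unfolding vec_eq_iff
  by (auto simp: H_matrix_def stack_def matrix_vector_mult_def sum_UNIV_sum_type sum_negf
      simp del: transpose_matrix_vector split: sum.splits)

text \<open>The constant charges are grouped with the memristor charge, which leaves one scalar
  nonlinearity per capacitor, as the mixed potential form requires.\<close>

lemma state_rhs_eq_stack:
  "state_rhs G RT RL R C L QM vC0 iL0 \<Phi>M0 x y
    = stack (- (H_alpha_alpha G RT RL R *v x) - H_alpha_beta G RT *v y
             - (\<chi> i. QM i (x $ i + \<Phi>M0 $ i) - QM i (\<Phi>M0 $ i) - C i * vC0 $ i))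
            (transpose (H_alpha_beta G RT) *v x - H_beta_beta G RT R *v y + diag L *v iL0)"
  unfolding vec_eq_iff state_rhs_def H_matrix_mult_stack
  by (auto simp: stack_def QMC_def simp del: transpose_matrix_vector split: sum.splits)

lemma transpose_H_alpha_alpha: "transpose (H_alpha_alpha G RT RL R) = H_alpha_alpha G RT RL R"
  by (simp add: H_alpha_alpha_def transpose_def vec_eq_iff mult_ac)

lemma C1_differentiable_imp_DERIV_deriv:
  fixes f :: "real \<Rightarrow> real"
  assumes "f C1_differentiable_on UNIV"
  shows "(f has_real_derivative deriv f x) (at x)"
  using assms unfolding C1_differentiable_on_def
  by (metis DERIV_imp_deriv UNIV_I has_real_derivative_iff_has_vector_derivative)

context RLCMa
begin

section \<open>Memristor charges and coercivity of their energy\<close>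

lemma QM_DERIV: "(QM i has_real_derivative deriv (QM i) x) (at x)"
  by (rule C1_differentiable_imp_DERIV_deriv[OF memristor_C1])

lemma QM_continuous: "continuous_on UNIV (QM i)"
  using QM_DERIV DERIV_isCont continuous_at_imp_continuous_on by blast

lemma QM_mono: "x \<le> y \<Longrightarrow> QM i x \<le> QM i y"
  using QM_DERIV memristor_passive by (meson DERIV_nonneg_imp_nondecreasing)

text \<open>Beyond \<open>\<Phi>m i\<close> the growth assumption applies. Up to
  \<open>\<Phi>m i\<close> the left side is nonpositive, while monotonicity and
  \<open>QM i 0 = 0\<close> make the charge nonnegative.\<close>

lemma QM_lower_bound:
  assumes "0 \<le> x"
  shows "Gm i * x - Gm i * \<Phi>m i \<le> QM i x"
proof (cases "x > \<Phi>m i")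
  case True
  then have "x > 0" using memristor_constants_pos(2)[of i] by simp
  then have "Gm i * x \<le> QM i x" using memristor_growth[of i x] True by (simp add: pos_le_divide_eq)
  moreover have "0 \<le> Gm i * \<Phi>m i" using memristor_constants_pos[of i] by simp
  ultimately show ?thesis by linarith
next
  case False
  then have "Gm i * x \<le> Gm i * \<Phi>m i" using memristor_constants_pos[of i] by simp
  moreover have "0 \<le> QM i x" using QM_mono[OF assms, of i] memristor_zero[of i] by simp
  ultimately show ?thesis by linarith
qed

text \<open>The mirror image; dividing by a negative flux reverses the growth inequality.\<close>

lemma QM_upper_bound:
  assumes "x \<le> 0"
  shows "QM i x \<le> Gm i * x + Gm i * \<Phi>m i"
proof (cases "- x > \<Phi>m i")
  case True
  then have "x < 0" using memristor_constants_pos(2)[of i] by simp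
  then have "QM i x \<le> Gm i * x" using memristor_growth[of i x] True by (simp add: neg_le_divide_eq)
  moreover have "0 \<le> Gm i * \<Phi>m i" using memristor_constants_pos[of i] by simp
  ultimately show ?thesis by linarith
next
  case False
  then have "Gm i * (- x) \<le> Gm i * \<Phi>m i"
    using memristor_constants_pos[of i] by (intro mult_left_mono) auto
  moreover have "QM i x \<le> 0" using QM_mono[OF assms, of i] memristor_zero[of i] by simp
  ultimately show ?thesis by simp
qed

lemma memristor_energy_growth:
  assumes "h < Gm i" and F: "\<And>x. (F has_real_derivative QM i x) (at x)"
  shows "\<exists>e. \<forall>x. h / 2 * x\<^sup>2 - e \<le> F (x + w) - a * x"
  using F QM_lower_bound QM_upper_bound assms(1)
  by (rule shifted_antiderivative_quadratic_growth)

lemma coercive_potential: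
  assumes gap: "\<bar>least_eigenvalue P\<bar> < Min (range Gm)" and P: "transpose P = P"
    and F: "\<And>i x. (F i has_real_derivative QM i x) (at x)"
  shows "\<exists>\<kappa>>0. \<exists>d. \<forall>x. \<kappa> * (norm x)\<^sup>2 - d
    \<le> x \<bullet> (P *v x) / 2 + (\<Sum>i\<in>UNIV. F i (x $ i + w $ i) - a i * x $ i)"
proof -
  define \<mu> where "\<mu> = least_eigenvalue P"
  \<comment> \<open>The midpoint between the two sides of \<open>gap\<close>: the room above
    \<open>h\<close> absorbs the linear terms of the memristor energies, and the room below
    outweighs the negative part of \<open>P\<close>.\<close>
  define h where "h = (Min (range Gm) + \<bar>\<mu>\<bar>) / 2"
  have h: "\<bar>\<mu>\<bar> < h" "h < Min (range Gm)" using gap by (auto simp: h_def \<mu>_def)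
  have "h < Gm i" for i using h(2) by simp
  then have "\<exists>e. \<forall>x. h / 2 * x\<^sup>2 - e \<le> F i (x + w $ i) - a i * x" for i
    using F by (rule memristor_energy_growth)
  then obtain e where e: "\<And>i x. h / 2 * x\<^sup>2 - e i \<le> F i (x + w $ i) - a i * x" by metis
  have "(h - \<bar>\<mu>\<bar>) / 2 * (norm x)\<^sup>2 - sum e UNIV
      \<le> x \<bullet> (P *v x) / 2 + (\<Sum>i\<in>UNIV. F i (x $ i + w $ i) - a i * x $ i)" for x
  proof -
    have "- \<bar>\<mu>\<bar> * (norm x)\<^sup>2 \<le> \<mu> * (norm x)\<^sup>2" by (intro mult_right_mono) auto
    also have "\<dots> \<le> x \<bullet> (P *v x)"
      unfolding \<mu>_def by (rule least_eigenvalue_le_quadratic_form[OF P])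
    finally have "- \<bar>\<mu>\<bar> * (norm x)\<^sup>2 \<le> x \<bullet> (P *v x)" .
    moreover have "h / 2 * (norm x)\<^sup>2 - sum e UNIV = (\<Sum>i\<in>UNIV. h / 2 * (x $ i)\<^sup>2 - e i)"
      unfolding power2_norm_eq_inner
      by (simp add: inner_vec_def sum_subtractf sum_distrib_left power2_eq_square)
    moreover have "\<dots> \<le> (\<Sum>i\<in>UNIV. F i (x $ i + w $ i) - a i * x $ i)"
      by (intro sum_mono e)
    ultimately show ?thesis by (simp add: algebra_simps)
  qed
  moreover have "(h - \<bar>\<mu>\<bar>) / 2 > 0" using h(1) by simp
  ultimately show ?thesis by blast
qed

end

lemma is_interval_time_interval: "is_interval (time_interval \<tau>)"
  unfolding is_interval_1 time_interval_def
  by (auto intro: le_less_trans[of "ereal _" "ereal _"])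

section \<open>The circuit as a mixed potential system\<close>

theorem theorem3:
  fixes G :: "('v, 'c::finite, 'l::finite, 'r) network"
    and RT RL :: "'r set"
    and R :: "'r \<Rightarrow> real" and C :: "'c \<Rightarrow> real" and L :: "'l \<Rightarrow> real"
    and QM :: "'c \<Rightarrow> real \<Rightarrow> real" and Gm \<Phi>m :: "'c \<Rightarrow> real"
    and vC0 \<Phi>M0 :: "real^'c" and iL0 :: "real^'l"
    and \<tau> :: ereal and \<phi> :: "real \<Rightarrow> real^'c" and q :: "real \<Rightarrow> real^'l"
  assumes circuit: "RLCMa G RT RL R C L QM Gm \<Phi>m"
    and cond1: "Min (range Gm) > \<bar>least_eigenvalue (H_alpha_alpha G RT RL R)\<bar>"
    and cond2: "positive_definite (H_beta_beta G RT R)"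
    and cond3: "spectral_norm (diag (\<lambda>j. sqrt (L j)) ** matrix_inv (H_beta_beta G RT R)
                  ** transpose (H_alpha_beta G RT) ** diag (\<lambda>i. 1 / sqrt (C i))) < 1"
    and interval: "\<tau> > 0"
    and solution: "is_solution G RT RL R C L QM vC0 iL0 \<Phi>M0 \<tau> \<phi> q"
  shows "bounded ((\<lambda>t. (\<phi> t, q t)) ` time_interval \<tau>)
    \<and> (\<tau> = \<infinity> \<longrightarrow>
         converges_to_set (\<lambda>t. (\<phi> t, q t)) (equilibria G RT RL R C L QM vC0 iL0 \<Phi>M0)
       \<and> (discrete (equilibria G RT RL R C L QM vC0 iL0 \<Phi>M0) \<longrightarrow>
            (\<exists>e \<in> equilibria G RT RL R C L QM vC0 iL0 \<Phi>M0.
               ((\<lambda>t. (\<phi> t, q t)) \<longlongrightarrow> e) at_top)))"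
proof -
  interpret RLCMa G RT RL R C L QM Gm \<Phi>m by (rule circuit)
  define P where "P = H_alpha_alpha G RT RL R"
  define N where "N = H_alpha_beta G RT"
  define B where "B = H_beta_beta G RT R"
  define S where "S = matrix_inv B ** transpose N"
  \<comment> \<open>Chosen so that \<open>B *v s\<close> is the source
    \<open>diag L *v iL0\<close>.\<close>
  define s where "s = matrix_inv B *v (diag L *v iL0)"
  \<comment> \<open>The matrix of \<open>cond3\<close>, with \<open>S\<close> as its middle part;
    its norm is the contraction constant \<open>k\<close>.\<close>
  define K where "K = diag (\<lambda>j. sqrt (L j)) ** matrix_inv B ** transpose N ** diag (\<lambda>i. 1 / sqrt (C i))"
  \<comment> \<open>\<open>a i\<close> collects the constant charges, so that \<open>g i\<close> is
    the shifted memristor charge minus a constant and has the potential \<open>J i\<close>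
    below.\<close>
  define a where "a i = QM i (\<Phi>M0 $ i) + C i * vC0 $ i" for i
  define g where "g i x = QM i (x + \<Phi>M0 $ i) - a i" for i x
  let ?E = "equilibria G RT RL R C L QM vC0 iL0 \<Phi>M0"
  let ?I = "time_interval \<tau>"
  define u where "u t = (\<phi> t, q t)" for t

  have B_inv: "B ** matrix_inv B = mat 1"
    using cond2 unfolding B_def by (rule positive_definite_mult_matrix_inv)
  have P_sym: "transpose P = P" by (simp add: P_def transpose_H_alpha_alpha)
  obtain F where F: "\<And>i x. (F i has_real_derivative QM i x) (at x)"
    using antiderivative_real[OF QM_continuous] by metis
  define J where "J i x = F i (x + \<Phi>M0 $ i) - a i * x" for i x
  obtain \<kappa> d where \<kappa>: "\<kappa> > 0" and coercive:
    "\<And>x. \<kappa> * (norm x)\<^sup>2 - d \<le> x \<bullet> (P *v x) / 2 + (\<Sum>i\<in>UNIV. J i (x $ i))"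
    using coercive_potential[OF cond1[folded P_def] P_sym F, of \<Phi>M0 a] unfolding J_def by blast

  interpret M: mixed_potential_system P N B S s C L g J "spectral_norm K" \<kappa> d
  proof
    show "B ** S = transpose N" by (simp add: S_def matrix_mul_assoc B_inv)
    show "continuous_on UNIV (g i)" for i
      unfolding g_def by (intro continuous_intros continuous_on_compose2[OF QM_continuous]) auto
    show "(J i has_real_derivative g i x) (at x)" for i x
      unfolding J_def g_def by (auto intro!: derivative_eq_intros DERIV_chain2[OF F])
    show "norm (diag (\<lambda>j. sqrt (L j)) *v (S *v (diag (\<lambda>i. 1 / sqrt (C i)) *v v)))
        \<le> spectral_norm K * norm v" for v
      using norm_matrix_le_spectral_norm[of K v]
      by (simp add: K_def S_def matrix_vector_mul_assoc matrix_mul_assoc)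
    show "0 \<le> spectral_norm K"
      unfolding spectral_norm_def by (rule onorm_pos_le) (rule matrix_vector_mul_bounded_linear)
    show "spectral_norm K < 1" using cond3 by (simp only: K_def B_def N_def)
    show "positive_definite B" using cond2 by (simp only: B_def)
  qed (fact P_sym capacitances inductances \<kappa> coercive)+

  have Bs: "B *v s = diag L *v iL0" by (simp add: s_def matrix_vector_mul_assoc matrix_mul_assoc B_inv)
  have rhs: "state_rhs G RT RL R C L QM vC0 iL0 \<Phi>M0 x y = stack (M.rhs_x x y) (M.rhs_y x y)" for x y
    unfolding state_rhs_eq_stack M.rhs_x_def M.rhs_y_def M.G_def Bs
    unfolding g_def a_def P_def N_def B_def by (simp add: algebra_simps)
  have "stack 0 0 = 0" by (auto simp: stack_def vec_eq_iff split: sum.splits)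
  \<comment> \<open>Stacking is injective and the weights \<open>C\<close>, \<open>L\<close> are
    nonzero, so equilibria are exactly the zeros of the field.\<close>
  then have "(x, y) \<in> ?E \<longleftrightarrow> M.field (x, y) = 0" for x y
    using stack_eq_iff[of "M.rhs_x x y" "M.rhs_y x y" 0 0]
    by (auto simp: equilibria_def rhs zero_prod_def M.field_eq_iff)
  then have E: "?E = {p. M.field p = 0}" by auto

  have u: "(u has_vector_derivative M.field (u t)) (at t within ?I)" if "t \<in> ?I" for t
  proof -
    obtain \<phi>' q' where d: "(\<phi> has_vector_derivative \<phi>') (at t within ?I)"
        "(q has_vector_derivative q') (at t within ?I)"
      and eq: "stack (diag C *v \<phi>') (diag L *v q') = stack (M.rhs_x (\<phi> t) (q t)) (M.rhs_y (\<phi> t) (q t))"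
      using solution \<open>t \<in> ?I\<close> unfolding is_solution_def rhs by blast
    have "M.field (u t) = (\<phi>', q')"
      using eq by (simp add: u_def M.field_eq_iff stack_eq_iff)
    then show ?thesis unfolding u_def using has_vector_derivative_Pair[OF d] by simp
  qed
  \<comment> \<open>Positivity of \<open>\<tau>\<close> puts 0 into the interval. The bound also
    holds for finite \<open>\<tau>\<close>, which excludes blow-up in finite time.\<close>
  have bdd: "bounded (u ` ?I)"
    using interval by (intro M.bounded_solution is_interval_time_interval u)
      (auto simp: time_interval_def zero_ereal_def)
  have limits: "converges_to_set u ?E \<and> (discrete ?E \<longrightarrow> (\<exists>e\<in>?E. (u \<longlongrightarrow> e) at_top))" if "\<tau> = \<infinity>"
  proof -
    have I: "?I = {0..}" using that by (auto simp: time_interval_def)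
    have lim: "((\<lambda>t. M.field (u t)) \<longlongrightarrow> 0) at_top"
      using u by (intro M.field_tendsto_0) (simp add: I)
    have "continuous_on {0..} u"
      using u unfolding I by (meson atLeast_iff continuous_on_eq_continuous_within has_vector_derivative_continuous)
    then show ?thesis
      using converges_to_zero_set[OF M.continuous_field lim] tendsto_isolated_zero[OF M.continuous_field lim]
        bdd unfolding E I by auto
  qed
  show ?thesis using bdd limits unfolding u_def by blast
qed

end
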